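(* Let $E$ be a Hilbert $\mathcal{A}$-module over a unital $C^*$-algebra $\mathcal{A}$, let $K \in L(E)$, and let $\{x_n\}_{n\in\mathbb{J}}$ and $\{y_n\}_{n\in\mathbb{J}}$ be two $K$-frames for $E$. Let $L_1, L_2 \in L(\ell^2(\mathcal{A}),E)$ be operators such that $L_1 e_n = x_n$ and $L_2 e_n = y_n$ for all $n\in\mathbb{J}$, with $R(K)\subseteq R(L_1)$ and $R(K)\subseteq R(L_2)$, where $\{e_n\}_{n\in\mathbb{J}}$ is the canonical orthonormal basis of $\ell^2(\mathcal{A})$. If $L_1L_2^*$ and $L_2L_1^*$ are positive operators and $R(L_1)+R(L_2)$ is closed, then $\{x_n+y_n\}_{n\in\mathbb{J}}$ is a $K$-frame for $E$.
   Context: Hilbert $\mathcal{A}$-modules are left modules with $\mathcal{A}$-valued inner product that is $\mathcal{A}$-linear in the first argument. $L(E,F)$ is the set of adjointable operators from $E$ to $F$, $L(E)=L(E,E)$, and $R(T)$ is the range of $T$. $\mathbb{J}$ is a countable index set. $\ell^2(\mathcal{A})$ is the Hilbert $\mathcal{A}$-module of all families $\{a_n\}_{n\in\mathbb{J}}\subseteq\mathcal{A}$ such that $\sum_n a_na_n^*$ converges in norm in $\mathcal{A}$, with inner product $\langle\{a_n\},\{b_n\}\rangle=\sum_n a_nb_n^*$; $e_n$ is the element with $1_{\mathcal{A}}$ in position $n$ and $0$ elsewhere. For $K\in L(E)$, a sequence $\{x_n\}_{n\in\mathbb{J}}\subset E$ is a $K$-frame for $E$ if there exist constants $C,D>0$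 such that $C\langle K^*x,K^*x\rangle\leq\sum_n\langle x,x_n\rangle\langle x_n,x\rangle\leq D\langle x,x\rangle$ for all $x\in E$, where the sum converges in norm. *)

theory Defs
  imports "HOL-Analysis.Analysis"
begin

section \<open>Unital C*-algebras\<close>

text \<open>
  The real Banach algebra structure comes from the library; complex scalars and the involution
  are added.  As usual for unital C*-algebras, \<open>1 \<noteq> 0\<close> (and hence \<open>norm 1 = 1\<close>).
\<close>

class unital_cstar_algebra = real_normed_algebra_1 + banach +
  fixes scaleC :: "complex \<Rightarrow> 'a \<Rightarrow> 'a"  (infixr "*\<^sub>C" 75)
    and star :: "'a \<Rightarrow> 'a"
  assumes scaleC_add_right: "c *\<^sub>C (a + b) = c *\<^sub>C a + c *\<^sub>C b"
    and scaleC_add_left: "(c + d) *\<^sub>C a = c *\<^sub>C a + d *\<^sub>C a"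
    and scaleC_scaleC: "c *\<^sub>C d *\<^sub>C a = (c * d) *\<^sub>C a"
    and scaleR_eq_scaleC: "r *\<^sub>R a = complex_of_real r *\<^sub>C a"
    and scaleC_mult_left: "(c *\<^sub>C a) * b = c *\<^sub>C (a * b)"
    and scaleC_mult_right: "a * (c *\<^sub>C b) = c *\<^sub>C (a * b)"
    and norm_scaleC: "norm (c *\<^sub>C a) = cmod c * norm a"
    and star_add: "star (a + b) = star a + star b"
    and star_scaleC: "star (c *\<^sub>C a) = cnj c *\<^sub>C star a"
    and star_mult: "star (a * b) = star b * star a"
    and star_star: "star (star a) = a"
    and cstar_identity: "norm (star a * a) = (norm a)\<^sup>2"

definition spectrum :: "'a::unital_cstar_algebra \<Rightarrow> complex set" where
  "spectrum a = {c. \<not> (\<exists>b. (c *\<^sub>C 1 - a) * b = 1 \<and> b * (c *\<^sub>C 1 - a) = 1)}"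

definition cstar_positive :: "'a::unital_cstar_algebra \<Rightarrow> bool" where
  "cstar_positive a \<longleftrightarrow> star a = a \<and> spectrum a \<subseteq> \<real>\<^sub>\<ge>\<^sub>0"

definition cstar_le :: "'a::unital_cstar_algebra \<Rightarrow> 'a \<Rightarrow> bool"  (infix "\<le>\<^sub>A" 50) where
  "a \<le>\<^sub>A b \<longleftrightarrow> cstar_positive (b - a)"


section \<open>Hilbert modules\<close>

text \<open>
  Completeness and the topology of \<open>E\<close> come from the class \<open>banach\<close>, the axiom \<open>norm_eq\<close> forcing
  the norm to be the one induced by the inner product.  Complex scalars act on \<open>E\<close> through
  \<open>c \<mapsto> smult (c *\<^sub>C 1)\<close>; \<open>scaleR_eq\<close> forces the real scalars of the class to act in the same way.
\<close>

locale hilbert_cstar_module =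
  fixes smult :: "'a::unital_cstar_algebra \<Rightarrow> 'e::banach \<Rightarrow> 'e"
    and ip :: "'e \<Rightarrow> 'e \<Rightarrow> 'a"
  assumes smult_add_right: "smult a (x + y) = smult a x + smult a y"
    and smult_add_left: "smult (a + b) x = smult a x + smult b x"
    and smult_smult: "smult a (smult b x) = smult (a * b) x"
    and smult_one: "smult 1 x = x"
    and scaleR_eq: "r *\<^sub>R x = smult (r *\<^sub>R 1) x"
    and ip_add_left: "ip (x + y) z = ip x z + ip y z"
    and ip_smult_left: "ip (smult a x) y = a * ip x y"
    and ip_star: "star (ip x y) = ip y x"
    and ip_positive: "cstar_positive (ip x x)"
    and ip_definite: "ip x x = 0 \<Longrightarrow> x = 0"
    and norm_eq: "norm x = sqrt (norm (ip x x))"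

text \<open>
  The module of square-summable families over \<open>J\<close>.  A family \<open>{a\<^sub>n}\<close>, \<open>n \<in> J\<close>, is represented by
  a function vanishing outside \<open>J\<close>.  Sums over \<open>J\<close> are norm limits of the net of finite partial
  sums; for sums of positive elements this agrees with convergence of the series along any
  enumeration of \<open>J\<close>.
\<close>

definition l2 :: "'i set \<Rightarrow> ('i \<Rightarrow> 'a::unital_cstar_algebra) set" where
  "l2 J = {a. (\<forall>n. n \<notin> J \<longrightarrow> a n = 0) \<and> (\<lambda>n. a n * star (a n)) summable_on J}"

definition l2_inner :: "'i set \<Rightarrow> ('i \<Rightarrow> 'a::unital_cstar_algebra) \<Rightarrow> ('i \<Rightarrow> 'a) \<Rightarrow> 'a" where
  "l2_inner J a b = (\<Sum>\<^sub>\<infinity>n\<in>J. a n * star (b n))"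

definition l2_basis :: "'i \<Rightarrow> 'i \<Rightarrow> 'a::unital_cstar_algebra" where
  "l2_basis n = (\<lambda>m. if m = n then 1 else 0)"


section \<open>Adjointable operators\<close>

text \<open>
  A module enters these definitions through its underlying set and its inner product, so that they
  apply both to \<open>E\<close> (with \<open>UNIV\<close>) and to \<open>l2 J\<close>.  Linearity is not required separately: it follows
  from the adjoint relation.  The values of an operator outside its domain are irrelevant.
\<close>

definition is_adjoint ::
    "'e set \<Rightarrow> ('e \<Rightarrow> 'e \<Rightarrow> 'a) \<Rightarrow> 'f set \<Rightarrow> ('f \<Rightarrow> 'f \<Rightarrow> 'a) \<Rightarrow> ('e \<Rightarrow> 'f) \<Rightarrow> ('f \<Rightarrow> 'e) \<Rightarrow> bool" where
  "is_adjoint E ipE F ipF T S \<longleftrightarrow>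
     T \<in> E \<rightarrow> F \<and> S \<in> F \<rightarrow> E \<and> (\<forall>x\<in>E. \<forall>y\<in>F. ipF (T x) y = ipE x (S y))"

definition adjointable ::
    "'e set \<Rightarrow> ('e \<Rightarrow> 'e \<Rightarrow> 'a) \<Rightarrow> 'f set \<Rightarrow> ('f \<Rightarrow> 'f \<Rightarrow> 'a) \<Rightarrow> ('e \<Rightarrow> 'f) set" where
  "adjointable E ipE F ipF = {T. \<exists>S. is_adjoint E ipE F ipF T S}"

text \<open>The adjoint is determined uniquely on \<open>F\<close>, since inner products are definite.\<close>

definition adj ::
    "'e set \<Rightarrow> ('e \<Rightarrow> 'e \<Rightarrow> 'a) \<Rightarrow> 'f set \<Rightarrow> ('f \<Rightarrow> 'f \<Rightarrow> 'a) \<Rightarrow> ('e \<Rightarrow> 'f) \<Rightarrow> 'f \<Rightarrow> 'e" where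
  "adj E ipE F ipF T = (SOME S. is_adjoint E ipE F ipF T S)"

definition positive_operator ::
    "('e \<Rightarrow> 'e \<Rightarrow> 'a::unital_cstar_algebra) \<Rightarrow> ('e \<Rightarrow> 'e) \<Rightarrow> bool" where
  "positive_operator ip T \<longleftrightarrow>
     T \<in> adjointable UNIV ip UNIV ip \<and> (\<forall>x. cstar_positive (ip (T x) x))"


section \<open>Frames\<close>

definition K_frame ::
    "('e \<Rightarrow> 'e \<Rightarrow> 'a::unital_cstar_algebra) \<Rightarrow> ('e \<Rightarrow> 'e) \<Rightarrow> 'i set \<Rightarrow> ('i \<Rightarrow> 'e) \<Rightarrow> bool" where
  "K_frame ip K J x \<longleftrightarrow>
     (let K' = adj UNIV ip UNIV ip K in
      \<exists>C D :: real. C > 0 \<and> D > 0 \<and>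
        (\<forall>z. (\<lambda>n. ip z (x n) * ip (x n) z) summable_on J \<and>
             C *\<^sub>R ip (K' z) (K' z) \<le>\<^sub>A (\<Sum>\<^sub>\<infinity>n\<in>J. ip z (x n) * ip (x n) z) \<and>
             (\<Sum>\<^sub>\<infinity>n\<in>J. ip z (x n) * ip (x n) z) \<le>\<^sub>A D *\<^sub>R ip z z))"

end

theory Submission
  imports Defs
begin

text \<open>
  Fix \<open>z\<close> and put \<open>a\<^sub>n = \<langle>z, x\<^sub>n\<rangle>\<close>, \<open>b\<^sub>n = \<langle>z, y\<^sub>n\<rangle>\<close>; these are the coordinates of \<open>L\<^sub>1\<^sup>* z\<close> and
  \<open>L\<^sub>2\<^sup>* z\<close>.  The frame sum of \<open>x + y\<close> at \<open>z\<close> expands into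
  \<open>\<Sum> a a\<^sup>* + \<Sum> b b\<^sup>* + \<Sum> b a\<^sup>* + \<Sum> a b\<^sup>*\<close>.  The two cross terms are \<open>\<langle>L\<^sub>1 L\<^sub>2\<^sup>* z, z\<rangle>\<close> and
  \<open>\<langle>L\<^sub>2 L\<^sub>1\<^sup>* z, z\<rangle>\<close>, hence positive (\<open>cross_term_positive\<close>), so a lower frame bound of \<open>x\<close> is also one
  of \<open>x + y\<close>.  For the upper bound, \<open>(a + b)(a + b)\<^sup>* \<le> 2 a a\<^sup>* + 2 b b\<^sup>*\<close>, since the difference is
  \<open>(a - b)(a - b)\<^sup>*\<close>; the same inequality gives the convergence of the frame sum.

  What this presupposes is the order theory of a \<open>C\<^sup>*\<close>-algebra, starting from the definition of
  positivity by the spectrum: positive elements form a closed convex cone on which the norm is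
  monotone, and \<open>a a\<^sup>*\<close> is positive.  The development rests on the existence of square roots
  (\<open>sqrt_one_minus\<close>), obtained by a convergent iteration.  Roots give the dictionary between
  squares of selfadjoint elements, the norm inequality \<open>norm (t - a) \<le> t\<close>, and nonnegative spectrum
  (\<open>cstar_positive_iff_square\<close>) without the spectral radius formula or the continuous functional
  calculus.
\<close>


section \<open>Involution and scalars\<close>

lemma star_zero [simp]: "star (0::'a::unital_cstar_algebra) = 0"
  using star_add[of "0::'a" 0] by simp

lemma star_minus: "star (- a) = - star (a::'a::unital_cstar_algebra)"
  using star_add[of a "- a"] by (simp add: eq_neg_iff_add_eq_0 add.commute)

lemma star_diff: "star (a - b) = star a - star (b::'a::unital_cstar_algebra)"
  using star_add[of a "- b"] by (simp add: star_minus)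

lemma star_one [simp]: "star (1::'a::unital_cstar_algebra) = 1"
  using star_mult[of "star (1::'a)" 1] by (simp add: star_star)

lemma star_scaleR: "star (r *\<^sub>R a) = r *\<^sub>R star (a::'a::unital_cstar_algebra)"
  by (simp add: scaleR_eq_scaleC star_scaleC)

lemma norm_star [simp]: "norm (star a) = norm (a::'a::unital_cstar_algebra)"
proof -
  have le: "norm b \<le> norm (star b)" for b :: 'a
  proof -
    have "norm b * norm b \<le> norm (star b) * norm b"
      using norm_mult_ineq[of "star b" b] by (simp add: cstar_identity power2_eq_square)
    then show ?thesis
      by (cases "b = 0") (simp_all add: mult_le_cancel_right)
  qed
  show ?thesis using le[of a] le[of "star a"] by (simp add: star_star)
qed

lemma bounded_linear_star: "bounded_linear (star :: 'a::unital_cstar_algebra \<Rightarrow> 'a)"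
  by (rule bounded_linear_intro[where K = 1]) (simp_all add: star_add star_scaleR)

lemma bounded_linear_scaleC: "bounded_linear (scaleC c :: 'a::unital_cstar_algebra \<Rightarrow> 'a)"
  by (rule bounded_linear_intro[where K = "cmod c"])
    (simp_all add: scaleC_add_right norm_scaleC scaleR_eq_scaleC scaleC_scaleC mult.commute)

lemmas scaleC_diff_right = linear_diff[OF bounded_linear.linear[OF bounded_linear_scaleC]]

lemma scaleC_minus_one: "(-1) *\<^sub>C a = - (a::'a::unital_cstar_algebra)"
  using scaleR_eq_scaleC[of "-1" a] by simp

lemma scaleC_minus_left: "(- c) *\<^sub>C a = - (c *\<^sub>C (a::'a::unital_cstar_algebra))"
  using scaleC_scaleC[of "-1" c a] by (simp add: scaleC_minus_one)

lemma scaleC_one: "1 *\<^sub>C a = (a::'a::unital_cstar_algebra)"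
  using scaleR_eq_scaleC[of 1 a] by simp

lemma selfadjoint_norm_square:
  "star u = u \<Longrightarrow> norm (u * u) = (norm (u::'a::unital_cstar_algebra))\<^sup>2"
  using cstar_identity[of u] by simp


section \<open>Square roots\<close>

text \<open>
  The fixed points of \<open>y \<mapsto> (x + y\<^sup>2) / 2\<close> satisfy \<open>(1 - y)\<^sup>2 = 1 - x\<close>.  The iteration
  started at \<open>0\<close> is dominated, increment by increment, by the same iteration for the real number
  \<open>x = 1\<close>, which is increasing and bounded by \<open>1\<close>; hence it converges even when \<open>norm x = 1\<close>.
\<close>

primrec sqrt_iter :: "'a::real_normed_algebra_1 \<Rightarrow> nat \<Rightarrow> 'a" where
  "sqrt_iter x 0 = 0"
| "sqrt_iter x (Suc n) = (1/2) *\<^sub>R (x + sqrt_iter x n * sqrt_iter x n)"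

lemma sqrt_iter_commute:
  assumes "x * c = c * x"
  shows "sqrt_iter x n * c = c * sqrt_iter x n"
proof (induction n)
  case (Suc n)
  have "sqrt_iter x n * sqrt_iter x n * c = c * (sqrt_iter x n * sqrt_iter x n)"
    by (metis Suc mult.assoc)
  then show ?case using assms by (simp add: distrib_left distrib_right)
qed simp

lemma sqrt_iter_star:
  "star x = x \<Longrightarrow> star (sqrt_iter x n) = sqrt_iter (x::'a::unital_cstar_algebra) n"
  by (induction n) (simp_all add: star_add star_mult star_scaleR)

lemma real_sqrt_iter:
  "0 \<le> sqrt_iter (1::real) n \<and> sqrt_iter (1::real) n \<le> 1 \<and>
   sqrt_iter (1::real) n \<le> sqrt_iter 1 (Suc n)"
proof (induction n)
  case (Suc n)
  let ?t = "sqrt_iter (1::real)"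
  have "?t n * ?t n \<le> 1 * 1" using Suc by (intro mult_mono) auto
  moreover have "0 \<le> ?t n * ?t n" using Suc by simp
  moreover have "?t n * ?t n \<le> ?t (Suc n) * ?t (Suc n)"
    using Suc by (intro mult_mono) linarith+
  ultimately show ?case by auto
qed simp

lemma sqrt_iter_bounds:
  assumes "norm x \<le> 1"
  shows "norm (sqrt_iter x n) \<le> sqrt_iter 1 n"
    and "norm (sqrt_iter x (Suc n) - sqrt_iter x n) \<le> sqrt_iter 1 (Suc n) - sqrt_iter 1 n"
proof -
  let ?y = "sqrt_iter x" and ?t = "sqrt_iter (1::real)"
  have y: "norm (?y n) \<le> ?t n" for n
  proof (induction n)
    case (Suc n)
    have "norm (?y n * ?y n) \<le> ?t n * ?t n"
      using Suc by (meson mult_mono' norm_ge_zero norm_mult_ineq order_trans)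
    then show ?case
      using assms norm_triangle_ineq[of x "?y n * ?y n"] by simp
  qed simp
  then show "norm (?y n) \<le> ?t n" .
  show "norm (?y (Suc n) - ?y n) \<le> ?t (Suc n) - ?t n"
  proof (induction n)
    case 0
    then show ?case using assms by simp
  next
    case (Suc n)
    let ?d = "?y (Suc n) - ?y n" and ?s = "?y (Suc n) + ?y n"
    have "x * ?y n = ?y n * x" for n using sqrt_iter_commute[of x x n] by simp
    then have comm: "?y (Suc n) * ?y n = ?y n * ?y (Suc n)"
      by (rule sqrt_iter_commute)
    have step: "sqrt_iter z (Suc (Suc n)) - sqrt_iter z (Suc n)
      = (1/2) *\<^sub>R (sqrt_iter z (Suc n) * sqrt_iter z (Suc n) - sqrt_iter z n * sqrt_iter z n)"
      for z :: "'b::real_normed_algebra_1"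
      by (simp add: scaleR_right_diff_distrib scaleR_right_distrib)
    have "?y (Suc (Suc n)) - ?y (Suc n) = (1/2) *\<^sub>R (?d * ?s)"
      unfolding step[of x] using comm by (simp only: algebra_simps)
    moreover have "norm (?d * ?s) \<le> (?t (Suc n) - ?t n) * (?t (Suc n) + ?t n)"
    proof -
      have "norm ?s \<le> ?t (Suc n) + ?t n"
        using y[of n] y[of "Suc n"] norm_triangle_ineq[of "?y (Suc n)" "?y n"] by linarith
      then show ?thesis
        using Suc by (meson mult_mono' norm_ge_zero norm_mult_ineq order_trans)
    qed
    moreover have "?t (Suc (Suc n)) - ?t (Suc n)
        = (1/2) * ((?t (Suc n) - ?t n) * (?t (Suc n) + ?t n))"
      unfolding step[of 1] by (simp add: algebra_simps del: sqrt_iter.simps)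
    ultimately show ?case by simp
  qed
qed

lemma sqrt_iter_convergent:
  fixes x :: "'a::{real_normed_algebra_1,banach}"
  assumes "norm x \<le> 1"
  shows "convergent (sqrt_iter x)"
proof -
  let ?y = "sqrt_iter x" and ?t = "sqrt_iter (1::real)"
  have "incseq ?t" using real_sqrt_iter by (intro incseq_SucI) blast
  moreover have "Bseq ?t" using real_sqrt_iter by (intro BseqI'[where K = 1]) auto
  ultimately have "convergent ?t" by (auto intro: Bseq_mono_convergent simp: incseq_def)
  then have "summable (\<lambda>n. ?t (Suc n) - ?t n)"
    by (auto simp: convergent_def simp del: sqrt_iter.simps intro: telescope_summable)
  then have "summable (\<lambda>n. ?y (Suc n) - ?y n)"
    by (rule summable_comparison_test'[where N = 0]) (rule sqrt_iter_bounds(2)[OF assms])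
  then have "convergent (\<lambda>n. \<Sum>k<n. ?y (Suc k) - ?y k)"
    by (simp only: summable_iff_convergent)
  then show ?thesis by (simp only: sum_lessThan_telescope sqrt_iter.simps(1) diff_0_right)
qed

text \<open>
  The bound on \<open>1 - s\<close> makes the root positive in turn.  The last conjunct reflects that the root
  is a limit of polynomials in \<open>x\<close>; it makes products of roots selfadjoint where that is needed.
\<close>

lemma sqrt_one_minus:
  fixes x :: "'a::unital_cstar_algebra"
  assumes "star x = x" "norm x \<le> 1"
  shows "\<exists>s. star s = s \<and> s * s = 1 - x \<and> norm (1 - s) \<le> 1 \<and>
    (\<forall>c. x * c = c * x \<longrightarrow> s * c = c * s)"
proof -
  let ?y = "sqrt_iter x"
  obtain l where l: "?y \<longlonglongrightarrow> l"
    using sqrt_iter_convergent[OF assms(2)] by (auto simp: convergent_def)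
  have "(\<lambda>n. ?y (Suc n)) \<longlonglongrightarrow> (1/2) *\<^sub>R (x + l * l)"
    unfolding sqrt_iter.simps by (intro tendsto_intros l)
  then have fixpoint: "l = (1/2) *\<^sub>R (x + l * l)"
    using LIMSEQ_unique LIMSEQ_Suc[OF l] by blast
  have "2 *\<^sub>R l = x + l * l" by (subst fixpoint) simp
  then have "(1 - l) * (1 - l) = 1 - x"
    by (simp add: algebra_simps scaleR_2)
  moreover have "norm l \<le> 1"
    using sqrt_iter_bounds(1)[OF assms(2)] real_sqrt_iter
    by (intro LIMSEQ_le_const2[OF tendsto_norm[OF l]]) (meson order_trans)
  moreover have "star l = l"
    using bounded_linear.tendsto[OF bounded_linear_star l] l
    by (simp add: sqrt_iter_star[OF assms(1)] LIMSEQ_unique)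
  moreover have "(1 - l) * c = c * (1 - l)" if "x * c = c * x" for c
  proof -
    have "(\<lambda>n. ?y n * c) \<longlonglongrightarrow> l * c" "(\<lambda>n. c * ?y n) \<longlonglongrightarrow> c * l"
      by (intro tendsto_intros l)+
    then have "l * c = c * l" using LIMSEQ_unique by (simp add: sqrt_iter_commute[OF that])
    then show ?thesis by (simp add: left_diff_distrib right_diff_distrib)
  qed
  moreover have "1 - (1 - l) = l" by simp
  ultimately show ?thesis by (metis star_diff star_one)
qed


section \<open>Squares of selfadjoint elements\<close>

text \<open>
  The working notion of positivity: unlike nonnegativity of the spectrum, with which it turns out to
  agree, it supplies a root to compute with.
\<close>

definition selfadjoint_square :: "'a::unital_cstar_algebra \<Rightarrow> bool" where
  "selfadjoint_square a \<longleftrightarrow> (\<exists>u. star u = u \<and> u * u = a)"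

text \<open>The element \<open>p + \<i> q\<close> is unitary, and \<open>p\<close> is its real part.\<close>

lemma norm_le_one_of_commuting_squares:
  fixes p q :: "'a::unital_cstar_algebra"
  assumes "star p = p" "star q = q" "p * q = q * p" "p * p + q * q = 1"
  shows "norm p \<le> 1"
proof -
  define v where "v = p + \<i> *\<^sub>C q"
  have sv: "star v = p - \<i> *\<^sub>C q"
    unfolding v_def by (simp add: star_add star_scaleC assms scaleC_minus_left)
  have "star v * v = p * p + q * q"
    unfolding sv unfolding v_def
    by (simp add: algebra_simps scaleC_mult_left scaleC_mult_right scaleC_scaleC
        scaleC_diff_right scaleC_add_right scaleC_minus_one assms(3))
  then have "(norm v)\<^sup>2 = 1"
    using cstar_identity[of v] assms by simp
  then have "norm v = 1" using norm_ge_zero[of v] by (simp add: power2_eq_1_iff)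
  moreover have "2 *\<^sub>R p = v + star v"
    unfolding sv unfolding v_def by (simp add: scaleR_2)
  then have "2 * norm p \<le> norm v + norm (star v)"
    by (metis norm_scaleR norm_triangle_ineq abs_numeral)
  ultimately show ?thesis by simp
qed

text \<open>If \<open>1 - u\<^sup>2 = s\<^sup>2\<close> with \<open>s\<close> commuting with \<open>u\<close>, then \<open>s + \<i> u\<close> is unitary.\<close>

lemma norm_one_minus_square:
  fixes u :: "'a::unital_cstar_algebra"
  assumes "star u = u" "norm u \<le> 1"
  shows "norm (1 - u * u) \<le> 1"
proof -
  have "norm (u * u) \<le> 1"
    using assms by (simp add: selfadjoint_norm_square power_le_one)
  moreover have "star (u * u) = u * u" by (simp add: star_mult assms)
  ultimately obtain s where s: "star s = s" "s * s = 1 - u * u"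
      "\<And>c. u * u * c = c * (u * u) \<Longrightarrow> s * c = c * s"
    using sqrt_one_minus[of "u * u"] by blast
  have "s * u = u * s" by (rule s(3)) (simp add: mult.assoc)
  then have "norm s \<le> 1"
    using s(1,2) by (intro norm_le_one_of_commuting_squares[of s u]) (simp_all add: assms)
  then show ?thesis
    using selfadjoint_norm_square[of s] s(1,2) by (simp add: power_le_one)
qed

text \<open>
  Together with its converse \<open>square_root\<close>, this describes squares by a norm inequality, which,
  unlike the existence of a root, adds up and passes to limits.
\<close>

lemma norm_diff_square:
  fixes u :: "'a::unital_cstar_algebra"
  assumes "star u = u" "norm (u * u) \<le> t"
  shows "norm (t *\<^sub>R 1 - u * u) \<le> t"
proof (cases "t > 0")
  case True
  define w where "w = (1 / sqrt t) *\<^sub>R u"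
  have "t * (1 / sqrt t * (1 / sqrt t)) = 1" using True by simp
  then have ut: "u * u = t *\<^sub>R (w * w)"
    unfolding w_def mult_scaleR_left mult_scaleR_right scaleR_scaleR by (simp only: scaleR_one)
  have "(norm u)\<^sup>2 \<le> (sqrt t)\<^sup>2" using assms True by (simp add: selfadjoint_norm_square)
  then have "norm u \<le> sqrt t" 
    by (rule power2_le_imp_le) (use True in simp)
  then have "norm w \<le> 1" using True by (simp add: w_def)
  moreover have "star w = w" by (simp add: w_def star_scaleR assms)
  ultimately have "norm (t *\<^sub>R (1 - w * w)) \<le> t"
    using norm_one_minus_square True by simp
  then show ?thesis by (simp add: ut scaleR_right_diff_distrib)
next
  case False
  then have "t = 0 \<and> u * u = 0"
    using assms(2) norm_ge_zero[of "u * u"] by (metis less_eq_real_def norm_le_zero_iff order_trans)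
  then show ?thesis by simp
qed

lemma square_root:
  fixes a :: "'a::unital_cstar_algebra"
  assumes "star a = a" "norm (t *\<^sub>R 1 - a) \<le> t"
  shows "\<exists>u. star u = u \<and> u * u = a \<and> norm (sqrt t *\<^sub>R 1 - u) \<le> sqrt t \<and>
    (\<forall>c. a * c = c * a \<longrightarrow> u * c = c * u)"
proof (cases "t > 0")
  case True
  define x where "x = (1/t) *\<^sub>R (t *\<^sub>R 1 - a)"
  have a: "a = t *\<^sub>R (1 - x)" using True by (simp add: x_def scaleR_right_diff_distrib)
  have "star x = x" by (simp add: x_def star_scaleR star_diff assms)
  moreover have "norm x \<le> 1" using assms True by (simp add: x_def)
  ultimately obtain s where s: "star s = s" "s * s = 1 - x" "norm (1 - s) \<le> 1"
      "\<And>c. x * c = c * x \<Longrightarrow> s * c = c * s"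
    using sqrt_one_minus[of x] by blast
  have "sqrt t *\<^sub>R s * c = c * (sqrt t *\<^sub>R s)" if "a * c = c * a" for c
  proof -
    have "x * c = c * x" using that by (simp add: x_def left_diff_distrib right_diff_distrib)
    then show ?thesis using s(4) by simp
  qed
  moreover have "norm (sqrt t *\<^sub>R 1 - sqrt t *\<^sub>R s) \<le> sqrt t"
    using True s(3) by (simp add: scaleR_right_diff_distrib[symmetric])
  moreover have "(sqrt t *\<^sub>R s) * (sqrt t *\<^sub>R s) = a" "star (sqrt t *\<^sub>R s) = sqrt t *\<^sub>R s"
    using True s(1,2) by (simp_all add: star_scaleR a)
  ultimately show ?thesis by blast
next
  case False
  then have t: "t = 0" using assms(2) norm_ge_zero[of "t *\<^sub>R 1 - a"] by linarith
  then have "a = 0" using assms(2) by simp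
  then show ?thesis using t by (intro exI[of _ 0]) simp
qed

lemma selfadjoint_squareI:
  "star a = a \<Longrightarrow> norm (t *\<^sub>R 1 - a) \<le> t \<Longrightarrow> selfadjoint_square (a::'a::unital_cstar_algebra)"
  using square_root unfolding selfadjoint_square_def by blast

lemma selfadjoint_squareD:
  assumes "selfadjoint_square (a::'a::unital_cstar_algebra)"
  shows "star a = a" and "norm a \<le> t \<Longrightarrow> norm (t *\<^sub>R 1 - a) \<le> t"
  using assms norm_diff_square by (auto simp: selfadjoint_square_def star_mult)

lemma selfadjoint_square_commuting_root:
  assumes "selfadjoint_square (a::'a::unital_cstar_algebra)"
  obtains u where "selfadjoint_square u" "u * u = a" "\<And>c. a * c = c * a \<Longrightarrow> u * c = c * u"
  using square_root[of a "norm a"] selfadjoint_squareD[OF assms] selfadjoint_squareI by blast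

lemma selfadjoint_square_add:
  fixes a b :: "'a::unital_cstar_algebra"
  assumes "selfadjoint_square a" "selfadjoint_square b"
  shows "selfadjoint_square (a + b)"
proof (rule selfadjoint_squareI)
  show "star (a + b) = a + b" using assms by (simp add: star_add selfadjoint_squareD)
  have "norm ((norm a *\<^sub>R 1 - a) + (norm b *\<^sub>R 1 - b)) \<le> norm a + norm b"
    using assms selfadjoint_squareD(2) by (intro norm_triangle_mono) auto
  then show "norm ((norm a + norm b) *\<^sub>R 1 - (a + b)) \<le> norm a + norm b"
    by (simp add: algebra_simps)
qed

lemma selfadjoint_square_scaleR:
  fixes a :: "'a::unital_cstar_algebra"
  assumes "selfadjoint_square a" "r \<ge> 0"
  shows "selfadjoint_square (r *\<^sub>R a)"
proof -
  obtain u where "star u = u" "u * u = a" using assms by (auto simp: selfadjoint_square_def)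
  then show ?thesis unfolding selfadjoint_square_def
    using assms(2) by (intro exI[of _ "sqrt r *\<^sub>R u"]) (simp add: star_scaleR)
qed

lemma selfadjoint_square_scaleR_one: "r \<ge> 0 \<Longrightarrow> selfadjoint_square (r *\<^sub>R 1)"
  by (intro selfadjoint_square_scaleR) (auto simp: selfadjoint_square_def intro: exI[of _ 1])

lemma selfadjoint_square_sum:
  "(\<And>i. i \<in> F \<Longrightarrow> selfadjoint_square (f i)) \<Longrightarrow> selfadjoint_square (sum f F)"
proof (induction F rule: infinite_finite_induct)
  case (insert x F)
  then show ?case by (simp add: selfadjoint_square_add)
qed (use selfadjoint_square_scaleR_one[of 0] in simp_all)

lemma closed_selfadjoint_square: "closed {a::'a::unital_cstar_algebra. selfadjoint_square a}"
proof -
  have eq: "{a::'a. selfadjoint_square a}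
      = {a. star a = a} \<inter> {a. norm (norm a *\<^sub>R 1 - a) \<le> norm a}"
    by (auto intro: selfadjoint_squareI selfadjoint_squareD(1) selfadjoint_squareD(2)[OF _ order_refl])
  have "continuous_on UNIV (star :: 'a \<Rightarrow> 'a)"
    by (rule bounded_linear.continuous_on[OF bounded_linear_star continuous_on_id])
  then show ?thesis unfolding eq
    by (intro closed_Int closed_Collect_eq closed_Collect_le continuous_intros)
qed

text \<open>
  For \<open>t\<close> above the norm of \<open>b\<close>, \<open>t - a = (t - b) + (b - a)\<close> is positive.  Then \<open>a / t\<close> and
  \<open>1 - a / t\<close> have commuting roots \<open>p\<close> and \<open>q\<close>, and \<open>p + \<i> q\<close> is unitary.
\<close>

lemma selfadjoint_square_norm_mono:
  fixes a b :: "'a::unital_cstar_algebra"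
  assumes "selfadjoint_square a" "selfadjoint_square (b - a)"
  shows "norm a \<le> norm b"
proof -
  have strict: "norm a \<le> t" if t: "norm b \<le> t" "t > 0" for t
  proof -
    have b: "star b = b"
      using selfadjoint_squareD(1)[OF assms(1)] selfadjoint_squareD(1)[OF assms(2)]
      by (simp add: star_diff)
    have "selfadjoint_square (t *\<^sub>R 1 - b)"
      using t by (intro selfadjoint_squareI[where t = t]) (simp_all add: star_diff star_scaleR b)
    then have "selfadjoint_square ((t *\<^sub>R 1 - b) + (b - a))"
      by (rule selfadjoint_square_add) (rule assms)
    then have "selfadjoint_square ((1/t) *\<^sub>R (t *\<^sub>R 1 - a))"
      using t by (intro selfadjoint_square_scaleR) simp_all
    also have "(1/t) *\<^sub>R (t *\<^sub>R 1 - a) = 1 - (1/t) *\<^sub>R a"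
      using t by (simp add: scaleR_right_diff_distrib)
    finally obtain q where q: "selfadjoint_square q" "q * q = 1 - (1/t) *\<^sub>R a"
        "\<And>c. (1 - (1/t) *\<^sub>R a) * c = c * (1 - (1/t) *\<^sub>R a) \<Longrightarrow> q * c = c * q"
      by (rule selfadjoint_square_commuting_root) blast
    obtain p where p: "star p = p" "p * p = (1/t) *\<^sub>R a"
      using selfadjoint_square_scaleR[OF assms(1), of "1/t"] t
      by (auto simp: selfadjoint_square_def)
    have "norm p \<le> 1"
    proof (rule norm_le_one_of_commuting_squares[of p q])
      show "p * q = q * p"
        using q(3)[of p] unfolding p(2)[symmetric]
        by (simp add: left_diff_distrib right_diff_distrib mult.assoc)
    qed (use p q(1,2) selfadjoint_squareD(1) in simp_all)
    then have "norm ((1/t) *\<^sub>R a) \<le> 1"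
      using selfadjoint_norm_square[OF p(1)] p(2) by (simp add: power_le_one)
    then show ?thesis using t by simp
  qed
  show ?thesis
  proof (rule field_le_epsilon)
    fix e :: real assume "e > 0"
    then show "norm a \<le> norm b + e"
      by (intro strict) (simp_all add: add_nonneg_pos)
  qed
qed


section \<open>Positivity in terms of the spectrum\<close>

definition has_inverse :: "'a::monoid_mult \<Rightarrow> bool" where
  "has_inverse a \<longleftrightarrow> (\<exists>b. a * b = 1 \<and> b * a = 1)"

lemma has_inverse_scaleR:
  fixes a :: "'a::real_normed_algebra_1"
  assumes "has_inverse a" "r \<noteq> 0"
  shows "has_inverse (r *\<^sub>R a)"
proof -
  obtain b where "a * b = 1" "b * a = 1" using assms by (auto simp: has_inverse_def)
  then show ?thesis using assms(2) unfolding has_inverse_def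
    by (intro exI[of _ "(1/r) *\<^sub>R b"]) simp
qed

lemma has_inverse_one_minus:
  fixes x :: "'a::{real_normed_algebra_1,banach}"
  assumes "norm x < 1"
  shows "has_inverse (1 - x)"
proof -
  have s: "summable (\<lambda>n. x ^ n)" by (rule complete_algebra_summable_geometric[OF assms])
  let ?b = "\<Sum>n. x ^ n"
  have head: "(\<Sum>n. x ^ Suc n) = ?b - 1" using suminf_split_head[OF s] by simp
  have "x * ?b = ?b - 1" unfolding head[symmetric] using suminf_mult[OF s, of x] by simp
  moreover have "?b * x = ?b - 1"
    unfolding head[symmetric] using suminf_mult2[OF s, of x] by (simp add: power_commutes)
  ultimately show ?thesis unfolding has_inverse_def
    by (intro exI[of _ ?b]) (simp add: algebra_simps)
qed

text \<open>
  With \<open>t = norm a\<close>, the element \<open>s + a\<close> differs from the scalar \<open>s + t\<close> by \<open>t - a\<close>, whose norm is at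
  most \<open>t\<close>; so a Neumann series inverts it.
\<close>

lemma selfadjoint_square_has_inverse:
  fixes a :: "'a::unital_cstar_algebra"
  assumes "selfadjoint_square a" "s > 0"
  shows "has_inverse (s *\<^sub>R 1 + a)"
proof -
  define t where "t = norm a"
  define x where "x = (1/(s+t)) *\<^sub>R (t *\<^sub>R 1 - a)"
  have pos: "s + t > 0" using assms(2) by (simp add: t_def add_pos_nonneg)
  have "norm (t *\<^sub>R 1 - a) < s + t"
    using selfadjoint_squareD(2)[OF assms(1), of t] assms(2) by (simp add: t_def)
  then have "norm x < 1" using pos by (simp add: x_def)
  then have "has_inverse ((s + t) *\<^sub>R (1 - x))"
    using pos by (intro has_inverse_scaleR has_inverse_one_minus) auto
  moreover have "(s + t) *\<^sub>R x = t *\<^sub>R 1 - a" using pos by (simp add: x_def)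
  then have "(s + t) *\<^sub>R (1 - x) = s *\<^sub>R 1 + a"
    by (simp add: scaleR_right_diff_distrib scaleR_left_distrib)
  ultimately show ?thesis by simp
qed

text \<open>
  The set of \<open>s\<close> for which \<open>a + s\<close> is a square is a closed upper ray.  Its endpoint cannot be
  positive: if \<open>q = a + s\<close> is a square with inverse \<open>r\<close>, then
  \<open>q - \<delta> = q (1 - \<delta> r)\<close>, and for small \<open>\<delta>\<close> this is the square of the product of the commuting
  roots of \<open>q\<close> and \<open>1 - \<delta> r\<close>.
\<close>

lemma selfadjoint_square_if_has_inverse:
  fixes a :: "'a::unital_cstar_algebra"
  assumes a: "star a = a" and inv: "\<And>s. s > 0 \<Longrightarrow> has_inverse (s *\<^sub>R 1 + a)"
  shows "selfadjoint_square a"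
proof -
  define S where "S = {s. s \<ge> 0 \<and> selfadjoint_square (s *\<^sub>R 1 + a)}"
  have "norm a \<in> S" unfolding S_def
    by (auto simp: star_add star_scaleR a intro!: selfadjoint_squareI[where t = "norm a"])
  moreover have "closed S"
  proof -
    have "closed ((\<lambda>s. s *\<^sub>R 1 + a) -` {a. selfadjoint_square a})"
      by (intro closed_vimage closed_selfadjoint_square continuous_intros)
    moreover have "S = {0..} \<inter> (\<lambda>s. s *\<^sub>R 1 + a) -` {a. selfadjoint_square a}"
      by (auto simp: S_def)
    ultimately show ?thesis by (metis closed_Int closed_atLeast)
  qed
  moreover have bdd: "bdd_below S" unfolding S_def by (auto intro: bdd_belowI[of _ 0])
  ultimately have "Inf S \<in> S" using closed_contains_Inf by blast
  then have s0: "Inf S \<ge> 0" "selfadjoint_square (Inf S *\<^sub>R 1 + a)" unfolding S_def by auto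
  have "\<not> Inf S > 0"
  proof
    assume pos: "Inf S > 0"
    define q where "q = Inf S *\<^sub>R 1 + a"
    obtain r where r: "q * r = 1" "r * q = 1"
      using inv[OF pos] by (auto simp: q_def has_inverse_def)
    have q: "selfadjoint_square q" "star q = q" using s0 selfadjoint_squareD(1) by (auto simp: q_def)
    obtain p where p: "star p = p" "p * p = q" using q by (auto simp: selfadjoint_square_def)
    have "star r * q = 1" using r(1) q by (metis star_mult star_one)
    then have sr: "star r = r" using r by (metis mult.assoc mult_1_left mult_1_right)
    (* Staying below Inf S keeps Inf S - \<delta> nonnegative, as membership in S demands. *)
    define \<delta> where "\<delta> = min (Inf S) (1 / (norm r + 1))"
    have \<delta>: "\<delta> > 0" "\<delta> \<le> Inf S" using pos by (auto simp: \<delta>_def add_nonneg_pos)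
    have "\<delta> * norm r \<le> (1 / (norm r + 1)) * norm r"
      by (rule mult_right_mono) (auto simp: \<delta>_def)
    also have "\<dots> \<le> 1" by (simp add: divide_simps add_nonneg_pos)
    finally have "norm (\<delta> *\<^sub>R r) \<le> 1" using \<delta> by simp
    moreover have "star (\<delta> *\<^sub>R r) = \<delta> *\<^sub>R r" by (simp add: star_scaleR sr)
    ultimately obtain w where w: "star w = w" "w * w = 1 - \<delta> *\<^sub>R r"
        "\<And>c. (\<delta> *\<^sub>R r) * c = c * (\<delta> *\<^sub>R r) \<Longrightarrow> w * c = c * w"
      using sqrt_one_minus by blast
    have "r * p = r * p * (q * r)" using r by simp
    also have "\<dots> = r * (p * p) * p * r" by (simp add: p(2)[symmetric] mult.assoc)
    also have "\<dots> = p * r" using r p(2) by simp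
    finally have wp: "w * p = p * w" by (intro w(3)) simp
    have "(p * w) * (p * w) = q * (1 - \<delta> *\<^sub>R r)"
      unfolding w(2)[symmetric] p(2)[symmetric] by (metis wp mult.assoc)
    also have "\<dots> = (Inf S - \<delta>) *\<^sub>R 1 + a"
      using r by (simp add: right_diff_distrib q_def scaleR_left_diff_distrib)
    finally have "selfadjoint_square ((Inf S - \<delta>) *\<^sub>R 1 + a)"
      unfolding selfadjoint_square_def by (intro exI[of _ "p * w"]) (simp add: star_mult p(1) w(1) wp)
    then have "Inf S - \<delta> \<in> S" using \<delta> by (simp add: S_def)
    then show False using cInf_lower[OF _ bdd] \<delta> by fastforce
  qed
  then show ?thesis using s0 by (auto simp: order_le_less)
qed

text \<open>
  Split \<open>c - a = d + m\<close> with \<open>d = Re c - a\<close> selfadjoint and \<open>m = \<i> Im c\<close>.  Then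
  \<open>(d + m)(d - m) = d\<^sup>2 + (Im c)\<^sup>2\<close> is a square plus a positive scalar.
\<close>

lemma has_inverse_nonreal:
  fixes a :: "'a::unital_cstar_algebra"
  assumes a: "star a = a" and im: "Im c \<noteq> 0"
  shows "has_inverse (c *\<^sub>C 1 - a)"
proof -
  define d where "d = Re c *\<^sub>R 1 - a"
  have sd: "star d = d" by (simp add: d_def star_diff star_scaleR a)
  define m where "m = (\<i> * of_real (Im c)) *\<^sub>C (1::'a)"
  have "c *\<^sub>C (1::'a) = (of_real (Re c) + \<i> * of_real (Im c)) *\<^sub>C 1"
    by (rule arg_cong[where f = "\<lambda>z. z *\<^sub>C 1", OF complex_eq])
  also have "\<dots> = Re c *\<^sub>R 1 + m"
    by (simp only: m_def scaleC_add_left scaleR_eq_scaleC)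
  finally have ca: "c *\<^sub>C 1 - a = d + m" by (simp add: d_def)
  have dm: "d * m = m * d" by (simp add: m_def scaleC_mult_left scaleC_mult_right)
  have "(\<i> * of_real (Im c)) * (\<i> * of_real (Im c)) = of_real (- ((Im c)\<^sup>2))"
    by (simp add: complex_eq_iff power2_eq_square)
  then have "m * m = of_real (- ((Im c)\<^sup>2)) *\<^sub>C 1"
    by (simp only: m_def scaleC_mult_left scaleC_scaleC mult_1_left)
  then have mm: "m * m = - ((Im c)\<^sup>2 *\<^sub>R 1)"
    by (simp only: scaleR_eq_scaleC[symmetric] scaleR_minus_left)
  have "has_inverse ((Im c)\<^sup>2 *\<^sub>R 1 + d * d)"
    using im sd by (intro selfadjoint_square_has_inverse) (auto simp: selfadjoint_square_def)
  then obtain b where b: "((Im c)\<^sup>2 *\<^sub>R 1 + d * d) * b = 1" "b * ((Im c)\<^sup>2 *\<^sub>R 1 + d * d) = 1"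
    by (auto simp: has_inverse_def)
  have prod: "(d + m) * (d - m) = (Im c)\<^sup>2 *\<^sub>R 1 + d * d"
    "(d - m) * (d + m) = (Im c)\<^sup>2 *\<^sub>R 1 + d * d"
    using mm dm by (simp_all add: algebra_simps)
  have r: "(d + m) * ((d - m) * b) = 1" using b prod by (simp add: mult.assoc[symmetric])
  have l: "(b * (d - m)) * (d + m) = 1" using b prod by (simp add: mult.assoc)
  have "(d - m) * b = b * (d - m)" using r l by (metis mult.assoc mult_1_left mult_1_right)
  then show ?thesis using r l unfolding ca has_inverse_def by metis
qed

theorem cstar_positive_iff_square:
  "cstar_positive a \<longleftrightarrow> selfadjoint_square (a::'a::unital_cstar_algebra)"
proof
  assume pos: "cstar_positive a"
  show "selfadjoint_square a"
  proof (rule selfadjoint_square_if_has_inverse)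
    show "star a = a" using pos by (simp add: cstar_positive_def)
    fix s :: real assume "s > 0"
    then have "of_real (- s) \<notin> spectrum a"
      using pos unfolding cstar_positive_def by (auto simp: complex_nonneg_Reals_iff)
    then have "has_inverse ((- s) *\<^sub>R 1 - a)"
      by (auto simp: spectrum_def has_inverse_def scaleR_eq_scaleC)
    then have "has_inverse ((-1) *\<^sub>R ((- s) *\<^sub>R 1 - a))" by (rule has_inverse_scaleR) simp
    then show "has_inverse (s *\<^sub>R 1 + a)" by (simp add: add.commute)
  qed
next
  assume sq: "selfadjoint_square a"
  have "has_inverse (c *\<^sub>C 1 - a)" if "c \<notin> \<real>\<^sub>\<ge>\<^sub>0" for c
  proof (cases "Im c = 0")
    case True
    define r where "r = - Re c"
    have c: "c = of_real (- r)" and r: "r > 0"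
      using True that by (auto simp: r_def complex_nonneg_Reals_iff complex_eq_iff)
    have "has_inverse ((-1) *\<^sub>R (r *\<^sub>R 1 + a))"
      by (intro has_inverse_scaleR selfadjoint_square_has_inverse sq r) simp
    moreover have "(-1) *\<^sub>R (r *\<^sub>R 1 + a) = c *\<^sub>C 1 - a"
      unfolding c scaleR_eq_scaleC[of "- r", symmetric] by simp
    ultimately show ?thesis by simp
  qed (use has_inverse_nonreal selfadjoint_squareD(1)[OF sq] in blast)
  then show "cstar_positive a"
    unfolding cstar_positive_def spectrum_def has_inverse_def
    using selfadjoint_squareD(1)[OF sq] by blast
qed


section \<open>Positivity of \<open>a a\<^sup>*\<close>\<close>

text \<open>Jacobson's identity: if \<open>c\<close> inverts \<open>s + a b\<close>, then \<open>(1 - b c a) / s\<close> inverts \<open>s + b a\<close>.\<close>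

lemma has_inverse_swap:
  fixes a b :: "'a::real_normed_algebra_1"
  assumes "has_inverse (s *\<^sub>R 1 + a * b)" "s \<noteq> 0"
  shows "has_inverse (s *\<^sub>R 1 + b * a)"
proof -
  obtain c where c: "(s *\<^sub>R 1 + a * b) * c = 1" "c * (s *\<^sub>R 1 + a * b) = 1"
    using assms by (auto simp: has_inverse_def)
  then have c': "a * b * c = 1 - s *\<^sub>R c" "c * (a * b) = 1 - s *\<^sub>R c"
    by (simp_all add: distrib_left distrib_right eq_diff_eq add.commute)
  have "b * a * (b * c * a) = b * (a * b * c) * a" "b * c * a * (b * a) = b * (c * (a * b)) * a"
    by (simp_all add: mult.assoc)
  then have "(s *\<^sub>R 1 + b * a) * (1 - b * c * a) = s *\<^sub>R 1"
    "(1 - b * c * a) * (s *\<^sub>R 1 + b * a) = s *\<^sub>R 1"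
    unfolding c' by (simp_all add: algebra_simps)
  then show ?thesis using assms(2) unfolding has_inverse_def
    by (intro exI[of _ "(1/s) *\<^sub>R (1 - b * c * a)"]) simp
qed

text \<open>
  If \<open>- b b\<^sup>*\<close> is positive, so is \<open>- b\<^sup>* b\<close>, because both have the same spectrum apart from \<open>0\<close>.
  On the other hand \<open>b b\<^sup>* + b\<^sup>* b\<close> is positive, being twice the sum of the squares of the real and
  the imaginary part of \<open>b\<close>.  Thus \<open>b b\<^sup>*\<close> is both positive and negative.
\<close>

lemma mult_star_eq_zero_if_negative:
  fixes b :: "'a::unital_cstar_algebra"
  assumes neg: "selfadjoint_square (- (b * star b))"
  shows "b * star b = 0"
proof -
  have neg': "selfadjoint_square (- (star b * b))"
  proof (rule selfadjoint_square_if_has_inverse)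
    show "star (- (star b * b)) = - (star b * b)" by (simp add: star_minus star_mult star_star)
    fix s :: real assume "s > 0"
    then have "has_inverse (s *\<^sub>R 1 + b * (- star b))"
      using selfadjoint_square_has_inverse[OF neg] by simp
    then show "has_inverse (s *\<^sub>R 1 + - (star b * b))"
      using has_inverse_swap[of s b "- star b"] \<open>s > 0\<close> by simp
  qed
  define p where "p = b + star b"
  define q where "q = \<i> *\<^sub>C (b - star b)"
  have "star p = p" by (simp add: p_def star_add star_star add.commute)
  moreover have "star q = q"
    by (simp add: q_def star_scaleC star_diff star_star scaleC_minus_left scaleC_diff_right)
  ultimately have "selfadjoint_square (p * p + q * q)"
    by (intro selfadjoint_square_add) (auto simp: selfadjoint_square_def)
  then have "selfadjoint_square ((1/2) *\<^sub>R (p * p + q * q))"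
    by (rule selfadjoint_square_scaleR) simp
  moreover have "p * p + q * q = 2 *\<^sub>R (b * star b + star b * b)"
    unfolding p_def q_def
    by (simp add: scaleC_mult_left scaleC_mult_right scaleC_scaleC scaleC_minus_one
        scaleC_diff_right algebra_simps scaleR_2)
  ultimately have "selfadjoint_square (b * star b + star b * b)" by simp
  from selfadjoint_square_add[OF this neg']
  have "selfadjoint_square (b * star b)" by simp
  then have "norm (b * star b) \<le> norm (0::'a)"
    by (rule selfadjoint_square_norm_mono) (use neg in simp)
  then show ?thesis by simp
qed

text \<open>
  Let \<open>h = a a\<^sup>*\<close> and let \<open>n = (\<bar>h\<bar> - h) / 2\<close> be its negative part, so that \<open>h n = - n\<^sup>2\<close>.  Then
  \<open>b = n a\<close> has \<open>b b\<^sup>* = n h n = - n\<^sup>3\<close>, a negative element because \<open>n\<^sup>3 = n \<bar>h\<bar> n\<close> is the square of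
  \<open>\<bar>h\<bar>\<^bsup>1/2\<^esup> n\<close>.  Therefore \<open>n\<^sup>3 = 0\<close>, so \<open>n = 0\<close> and \<open>h = \<bar>h\<bar>\<close>.
\<close>

theorem selfadjoint_square_mult_star:
  fixes a :: "'a::unital_cstar_algebra"
  shows "selfadjoint_square (a * star a)"
proof -
  define h where "h = a * star a"
  have sh: "star h = h" by (simp add: h_def star_mult star_star)
  have "selfadjoint_square (h * h)" using sh by (auto simp: selfadjoint_square_def)
  (* m is the modulus of h *)
  then obtain m where m: "selfadjoint_square m" "m * m = h * h"
      "\<And>c. h * h * c = c * (h * h) \<Longrightarrow> m * c = c * m"
    by (rule selfadjoint_square_commuting_root) blast
  have mh: "m * h = h * m" by (rule m(3)) (simp add: mult.assoc)
  have sm: "star m = m" using m(1) selfadjoint_squareD(1) by blast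
  define n where "n = (1/2) *\<^sub>R (m - h)"
  have sn: "star n = n" by (simp add: n_def star_scaleR star_diff sm sh)
  have nn: "n * n = (1/2) *\<^sub>R (h * h - m * h)"
  proof -
    have "4 *\<^sub>R (n * n) = (m - h) * (m - h)" by (simp add: n_def)
    also have "\<dots> = 2 *\<^sub>R (h * h - m * h)"
      using m(2) mh by (simp add: algebra_simps scaleR_2)
    finally have "(1/4) *\<^sub>R (4 *\<^sub>R (n * n)) = (1/4) *\<^sub>R (2 *\<^sub>R (h * h - m * h))" by (rule arg_cong)
    then show ?thesis by simp
  qed
  have hn: "h * n = - (n * n)" unfolding nn using mh by (simp add: n_def algebra_simps)
  have mn: "m * n = n * n" unfolding nn using m(2) by (simp add: n_def algebra_simps)
  obtain s where s: "selfadjoint_square s" "s * s = m" "\<And>c. m * c = c * m \<Longrightarrow> s * c = c * s"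
    using selfadjoint_square_commuting_root[OF m(1)] by blast
  have ss: "star s = s" using s(1) selfadjoint_squareD(1) by blast
  have sn_comm: "s * n = n * s" by (rule s(3)) (simp add: n_def algebra_simps mh)
  have "(s * n) * (s * n) = n * (m * n)"
    by (metis sn_comm s(2) mult.assoc)
  then have cube: "(s * n) * (s * n) = n * (n * n)" by (simp add: mn)
  have "(n * a) * star (n * a) = n * (h * n)" by (simp add: h_def star_mult sn mult.assoc)
  then have b: "(n * a) * star (n * a) = - (n * (n * n))" by (simp add: hn)
  have "selfadjoint_square ((s * n) * (s * n))"
    unfolding selfadjoint_square_def by (intro exI[of _ "s * n"]) (simp add: star_mult ss sn sn_comm)
  then have "(n * a) * star (n * a) = 0"
    by (intro mult_star_eq_zero_if_negative) (simp add: b cube)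
  then have "n * (n * n) = 0" by (simp add: b)
  then have "(n * n) * (n * n) = 0" by (simp add: mult.assoc)
  then have "n = 0"
    using selfadjoint_norm_square[OF sn] selfadjoint_norm_square[of "n * n"] by (simp add: star_mult sn)
  then show ?thesis using m(1) by (simp add: n_def h_def)
qed


section \<open>Square-summable families\<close>

lemma selfadjoint_square_has_sum:
  fixes f :: "'i \<Rightarrow> 'a::unital_cstar_algebra"
  assumes "(f has_sum s) A" "\<And>i. i \<in> A \<Longrightarrow> selfadjoint_square (f i)"
  shows "selfadjoint_square s"
proof -
  have "eventually (\<lambda>F. sum f F \<in> {a. selfadjoint_square a}) (finite_subsets_at_top A)"
    using assms(2) by (intro eventually_finite_subsets_at_top_weakI)
      (auto intro!: selfadjoint_square_sum)
  then have "s \<in> {a. selfadjoint_square a}"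
    using assms(1) unfolding has_sum_def
    by (intro Lim_in_closed_set[OF closed_selfadjoint_square]) auto
  then show ?thesis by simp
qed

text \<open>
  Monotonicity of the norm on positive elements makes the finite partial sums of \<open>f\<close> inherit the
  Cauchy property from those of \<open>g\<close>.
\<close>

lemma summable_on_dominated:
  fixes f g :: "'i \<Rightarrow> 'a::unital_cstar_algebra"
  assumes g: "g summable_on A"
    and f: "\<And>i. i \<in> A \<Longrightarrow> selfadjoint_square (f i)"
    and fg: "\<And>i. i \<in> A \<Longrightarrow> selfadjoint_square (g i - f i)"
  shows "f summable_on A"
proof -
  obtain l where l: "(sum g \<longlongrightarrow> l) (finite_subsets_at_top A)"
    using g by (auto simp: summable_on_def has_sum_def)
  have "\<exists>P. eventually P (finite_subsets_at_top A) \<and>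
      (\<forall>F F'. P F \<and> P F' \<longrightarrow> dist (sum f F) (sum f F') < e)" if "e > 0" for e
  proof -
    have "eventually (\<lambda>F. dist (sum g F) l < e / 4) (finite_subsets_at_top A)"
      by (rule tendstoD[OF l]) (use that in simp)
    then obtain F0 where F0: "finite F0" "F0 \<subseteq> A"
        "\<And>F. finite F \<Longrightarrow> F0 \<subseteq> F \<Longrightarrow> F \<subseteq> A \<Longrightarrow> dist (sum g F) l < e / 4"
      unfolding eventually_finite_subsets_at_top by metis
    define P where "P F \<longleftrightarrow> finite F \<and> F0 \<subseteq> F \<and> F \<subseteq> A" for F
    have near: "dist (sum f F) (sum f F0) < e / 2" if "P F" for F
    proof -
      have F: "finite F" "F0 \<subseteq> F" "F \<subseteq> A" using that by (auto simp: P_def)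
      have "norm (sum f (F - F0)) \<le> norm (sum g (F - F0))"
        using F by (intro selfadjoint_square_norm_mono)
          (auto simp: sum_subtractf[symmetric] intro!: selfadjoint_square_sum f fg)
      then have "dist (sum f F) (sum f F0) \<le> dist (sum g F) (sum g F0)"
        using F by (simp add: dist_norm sum_diff)
      also have "\<dots> \<le> dist (sum g F) l + dist (sum g F0) l" by (rule dist_triangle2)
      also have "\<dots> < e / 4 + e / 4" using F F0 by (intro add_strict_mono F0(3)) auto
      finally show ?thesis by simp
    qed
    have "dist (sum f F) (sum f F') < e" if "P F" "P F'" for F F'
      using near[OF that(1)] near[OF that(2)] dist_triangle2[of "sum f F" "sum f F'" "sum f F0"]
      by linarith
    moreover have "eventually P (finite_subsets_at_top A)"
      unfolding P_def eventually_finite_subsets_at_top using F0(1,2) by blast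
    ultimately show ?thesis by blast
  qed
  then have "cauchy_filter (filtermap (sum f) (finite_subsets_at_top A))"
    by (simp add: cauchy_filter_metric_filtermap)
  moreover have "complete (UNIV :: 'a set)"
    by (meson Cauchy_convergent UNIV_I complete_def convergent_def)
  ultimately obtain k where "(sum f \<longlongrightarrow> k) (finite_subsets_at_top A)"
    using complete_uniform[where S = UNIV] by (force simp add: filterlim_def)
  then show ?thesis by (auto simp: summable_on_def has_sum_def)
qed

lemma parallelogram:
  fixes a b :: "'a::unital_cstar_algebra"
  shows "2 *\<^sub>R (a * star a + b * star b) - (a + b) * star (a + b) = (a - b) * star (a - b)"
  by (simp add: star_add star_diff algebra_simps scaleR_2)

lemma summable_on_add_mult_star:
  fixes a b :: "'i \<Rightarrow> 'a::unital_cstar_algebra"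
  assumes "(\<lambda>n. a n * star (a n)) summable_on J" "(\<lambda>n. b n * star (b n)) summable_on J"
  shows "(\<lambda>n. (a n + b n) * star (a n + b n)) summable_on J"
proof (rule summable_on_dominated)
  show "(\<lambda>n. 2 *\<^sub>R (a n * star (a n) + b n * star (b n))) summable_on J"
    by (intro summable_on_bounded_linear[OF bounded_linear_scaleR_right] summable_on_add assms)
qed (simp_all only: parallelogram selfadjoint_square_mult_star)

text \<open>
  Polarization: \<open>a b\<^sup>* + b a\<^sup>*\<close> is summable by the preceding lemma, and so is
  \<open>a (\<i> b)\<^sup>* + \<i> b a\<^sup>* = - \<i> (a b\<^sup>* - b a\<^sup>*)\<close>.
\<close>

lemma summable_on_mult_star:
  fixes a b :: "'i \<Rightarrow> 'a::unital_cstar_algebra"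
  assumes a: "(\<lambda>n. a n * star (a n)) summable_on J" and b: "(\<lambda>n. b n * star (b n)) summable_on J"
  shows "(\<lambda>n. a n * star (b n)) summable_on J"
proof -
  have sym: "(\<lambda>n. a n * star (c n) + c n * star (a n)) summable_on J"
    if c: "(\<lambda>n. c n * star (c n)) summable_on J" for c
  proof -
    have "(\<lambda>n. (a n + c n) * star (a n + c n) + (- (a n * star (a n)) + - (c n * star (c n))))
        summable_on J"
      by (intro summable_on_add summable_on_add_mult_star summable_on_uminus[THEN iffD2] a c)
    then show ?thesis by (simp add: star_add algebra_simps)
  qed
  have ib: "(\<i> *\<^sub>C d) * star (\<i> *\<^sub>C d) = d * star d" for d :: 'a
    by (simp add: star_scaleC scaleC_mult_left scaleC_mult_right scaleC_scaleC scaleC_one)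
  have "(\<lambda>n. (1/2) *\<^sub>R ((a n * star (b n) + b n * star (a n))
      + \<i> *\<^sub>C (a n * star (\<i> *\<^sub>C b n) + (\<i> *\<^sub>C b n) * star (a n)))) summable_on J"
    by (intro summable_on_bounded_linear[OF bounded_linear_scaleR_right] summable_on_add
        summable_on_bounded_linear[OF bounded_linear_scaleC] sym b) (simp add: ib b)
  moreover have "(1/2) *\<^sub>R ((c * star d + d * star c)
      + \<i> *\<^sub>C (c * star (\<i> *\<^sub>C d) + (\<i> *\<^sub>C d) * star c)) = c * star d" for c d :: 'a
    by (simp add: star_scaleC scaleC_mult_left scaleC_mult_right scaleC_scaleC scaleC_minus_one
        scaleC_one scaleC_add_right scaleR_2[symmetric])
  ultimately show ?thesis by simp
qed


section \<open>Sums of \<open>K\<close>-frames\<close>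

lemma is_adjoint_adj:
  "T \<in> adjointable E ipE F ipF \<Longrightarrow> is_adjoint E ipE F ipF T (adj E ipE F ipF T)"
  unfolding adjointable_def adj_def mem_Collect_eq by (rule someI_ex[of "is_adjoint E ipE F ipF T"])

lemma l2_basis_in_l2:
  assumes "n \<in> J"
  shows "(l2_basis n :: 'i \<Rightarrow> 'a::unital_cstar_algebra) \<in> l2 J"
proof -
  have "(\<lambda>m. l2_basis n m * star (l2_basis n m) :: 'a) summable_on {n}" by simp
  then have "(\<lambda>m. l2_basis n m * star (l2_basis n m) :: 'a) summable_on J"
    by (rule summable_on_cong_neutral[THEN iffD1, rotated -1]) (use assms in \<open>auto simp: l2_basis_def\<close>)
  then show ?thesis using assms by (auto simp: l2_def l2_basis_def)
qed

lemma l2_inner_basis: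
  assumes "n \<in> J"
  shows "l2_inner J (l2_basis n) b = star (b n :: 'a::unital_cstar_algebra)"
proof -
  have "l2_inner J (l2_basis n) b = (\<Sum>\<^sub>\<infinity>m\<in>{n}. l2_basis n m * star (b m))"
    unfolding l2_inner_def
    by (rule infsum_cong_neutral) (use assms in \<open>auto simp: l2_basis_def\<close>)
  then show ?thesis by (simp add: l2_basis_def)
qed

lemma (in hilbert_cstar_module) adj_coordinate:
  assumes "L \<in> adjointable (l2 J) (l2_inner J) UNIV ip" "n \<in> J"
  shows "adj (l2 J) (l2_inner J) UNIV ip L z n = ip z (L (l2_basis n))"
proof -
  have "ip (L (l2_basis n)) z = l2_inner J (l2_basis n) (adj (l2 J) (l2_inner J) UNIV ip L z)"
    using is_adjoint_adj[OF assms(1)] l2_basis_in_l2[OF assms(2)] by (auto simp: is_adjoint_def)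
  then show ?thesis
    using assms(2) by (metis ip_star l2_inner_basis star_star)
qed

lemma (in hilbert_cstar_module) ip_add_right: "ip z (x + y) = ip z x + ip z y"
  by (metis ip_add_left ip_star star_add)

text \<open>
  With \<open>a = L\<^sub>1\<^sup>* z\<close> and \<open>b = L\<^sub>2\<^sup>* z\<close>, this is \<open>\<langle>L\<^sub>2\<^sup>* z, L\<^sub>1\<^sup>* z\<rangle> = \<langle>L\<^sub>1 L\<^sub>2\<^sup>* z, z\<rangle>\<close>.
\<close>

lemma (in hilbert_cstar_module) cross_term_positive:
  assumes L1: "L1 \<in> adjointable (l2 J) (l2_inner J) UNIV ip"
    and L2: "L2 \<in> adjointable (l2 J) (l2_inner J) UNIV ip"
    and pos: "positive_operator ip (L1 \<circ> adj (l2 J) (l2_inner J) UNIV ip L2)"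
  shows "selfadjoint_square
    (\<Sum>\<^sub>\<infinity>n\<in>J. ip z (L2 (l2_basis n)) * star (ip z (L1 (l2_basis n))))"
proof -
  let ?S1 = "adj (l2 J) (l2_inner J) UNIV ip L1" and ?S2 = "adj (l2 J) (l2_inner J) UNIV ip L2"
  have "selfadjoint_square (ip (L1 (?S2 z)) z)"
    using pos by (simp add: positive_operator_def cstar_positive_iff_square)
  moreover have "ip (L1 (?S2 z)) z
      = (\<Sum>\<^sub>\<infinity>n\<in>J. ip z (L2 (l2_basis n)) * star (ip z (L1 (l2_basis n))))"
  proof -
    have "?S2 z \<in> l2 J" using is_adjoint_adj[OF L2] by (auto simp: is_adjoint_def)
    then have "ip (L1 (?S2 z)) z = l2_inner J (?S2 z) (?S1 z)"
      using is_adjoint_adj[OF L1] by (auto simp: is_adjoint_def)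
    also have "\<dots> = (\<Sum>\<^sub>\<infinity>n\<in>J. ip z (L2 (l2_basis n)) * star (ip z (L1 (l2_basis n))))"
      by (subst (1) l2_inner_def, rule infsum_cong) (simp add: adj_coordinate L1 L2)
    finally show ?thesis .
  qed
  ultimately show ?thesis by (simp only:)
qed

theorem theorem4p6:
  fixes smult :: "'a::unital_cstar_algebra \<Rightarrow> 'e::banach \<Rightarrow> 'e"
    and ip :: "'e \<Rightarrow> 'e \<Rightarrow> 'a"
    and J :: "'i set"
    and K :: "'e \<Rightarrow> 'e"
    and x y :: "'i \<Rightarrow> 'e"
    and L1 L2 :: "('i \<Rightarrow> 'a) \<Rightarrow> 'e"
  assumes "hilbert_cstar_module smult ip"
    and "countable J"
    and "K \<in> adjointable UNIV ip UNIV ip"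
    and "K_frame ip K J x"
    and "K_frame ip K J y"
    and "L1 \<in> adjointable (l2 J) (l2_inner J) UNIV ip"
    and "L2 \<in> adjointable (l2 J) (l2_inner J) UNIV ip"
    and "\<forall>n\<in>J. L1 (l2_basis n) = x n"
    and "\<forall>n\<in>J. L2 (l2_basis n) = y n"
    and "range K \<subseteq> L1 ` l2 J"
    and "range K \<subseteq> L2 ` l2 J"
    and "positive_operator ip (L1 \<circ> adj (l2 J) (l2_inner J) UNIV ip L2)"
    and "positive_operator ip (L2 \<circ> adj (l2 J) (l2_inner J) UNIV ip L1)"
    and "closed {u + v | u v. u \<in> L1 ` l2 J \<and> v \<in> L2 ` l2 J}"
  shows "K_frame ip K J (\<lambda>n. x n + y n)"
proof -
  interpret hilbert_cstar_module smult ip by (rule assms(1))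
  define K' where "K' = adj UNIV ip UNIV ip K"
  have frame: "K_frame ip K J w \<longleftrightarrow> (\<exists>C D. C > 0 \<and> D > 0 \<and>
      (\<forall>z. (\<lambda>n. ip z (w n) * star (ip z (w n))) summable_on J \<and>
        C *\<^sub>R ip (K' z) (K' z) \<le>\<^sub>A (\<Sum>\<^sub>\<infinity>n\<in>J. ip z (w n) * star (ip z (w n))) \<and>
        (\<Sum>\<^sub>\<infinity>n\<in>J. ip z (w n) * star (ip z (w n))) \<le>\<^sub>A D *\<^sub>R ip z z))" for w
    unfolding K_frame_def Let_def K'_def ip_star ..
  obtain C D1 where C: "C > 0" "D1 > 0"
    and X: "\<And>z. (\<lambda>n. ip z (x n) * star (ip z (x n))) summable_on J"
      "\<And>z. C *\<^sub>R ip (K' z) (K' z) \<le>\<^sub>A (\<Sum>\<^sub>\<infinity>n\<in>J. ip z (x n) * star (ip z (x n)))"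
      "\<And>z. (\<Sum>\<^sub>\<infinity>n\<in>J. ip z (x n) * star (ip z (x n))) \<le>\<^sub>A D1 *\<^sub>R ip z z"
    using assms(4) unfolding frame by blast
  obtain D2 where D2: "D2 > 0"
    and Y: "\<And>z. (\<lambda>n. ip z (y n) * star (ip z (y n))) summable_on J"
      "\<And>z. (\<Sum>\<^sub>\<infinity>n\<in>J. ip z (y n) * star (ip z (y n))) \<le>\<^sub>A D2 *\<^sub>R ip z z"
    using assms(5) unfolding frame by blast
  have "(\<lambda>n. ip z (x n + y n) * star (ip z (x n + y n))) summable_on J \<and>
      C *\<^sub>R ip (K' z) (K' z) \<le>\<^sub>A (\<Sum>\<^sub>\<infinity>n\<in>J. ip z (x n + y n) * star (ip z (x n + y n))) \<and>
      (\<Sum>\<^sub>\<infinity>n\<in>J. ip z (x n + y n) * star (ip z (x n + y n))) \<le>\<^sub>A (2 * (D1 + D2)) *\<^sub>R ip z z" for z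
  proof -
    define a where "a n = ip z (x n)" for n
    define b where "b n = ip z (y n)" for n
    have ab: "ip z (x n + y n) = a n + b n" for n by (simp add: a_def b_def ip_add_right)
    note a = X(1)[of z, folded a_def] and b = Y(1)[of z, folded b_def]
    define saa where "saa = (\<Sum>\<^sub>\<infinity>n\<in>J. a n * star (a n))"
    define sbb where "sbb = (\<Sum>\<^sub>\<infinity>n\<in>J. b n * star (b n))"
    define sab where "sab = (\<Sum>\<^sub>\<infinity>n\<in>J. a n * star (b n))"
    define sba where "sba = (\<Sum>\<^sub>\<infinity>n\<in>J. b n * star (a n))"
    define t where "t = (\<Sum>\<^sub>\<infinity>n\<in>J. (a n + b n) * star (a n + b n))"
    have saa: "((\<lambda>n. a n * star (a n)) has_sum saa) J"
      and sbb: "((\<lambda>n. b n * star (b n)) has_sum sbb) J"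
      and sab: "((\<lambda>n. a n * star (b n)) has_sum sab) J"
      and sba: "((\<lambda>n. b n * star (a n)) has_sum sba) J"
      unfolding saa_def sbb_def sab_def sba_def
      by (intro has_sum_infsum a b summable_on_mult_star)+
    have t_sum: "(\<lambda>n. (a n + b n) * star (a n + b n)) summable_on J"
      by (rule summable_on_add_mult_star[OF a b])
    then have t: "((\<lambda>n. (a n + b n) * star (a n + b n)) has_sum t) J"
      unfolding t_def by (rule has_sum_infsum)
    have "((\<lambda>n. (a n * star (a n) + b n * star (b n)) + (b n * star (a n) + a n * star (b n)))
        has_sum (saa + sbb) + (sba + sab)) J"
      by (intro has_sum_add saa sbb sab sba)
    then have "((\<lambda>n. (a n + b n) * star (a n + b n)) has_sum (saa + sbb) + (sba + sab)) J"
      by (simp add: star_add algebra_simps)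
    then have expand: "t = (saa + sbb) + (sba + sab)" using t has_sum_unique by blast
    have sba_pos: "selfadjoint_square sba"
    proof -
      have "sba = (\<Sum>\<^sub>\<infinity>n\<in>J. ip z (L2 (l2_basis n)) * star (ip z (L1 (l2_basis n))))"
        unfolding sba_def a_def b_def using assms(8,9) by (intro infsum_cong) simp
      then show ?thesis using cross_term_positive[OF assms(6,7,12)] by simp
    qed
    have sab_pos: "selfadjoint_square sab"
    proof -
      have "sab = (\<Sum>\<^sub>\<infinity>n\<in>J. ip z (L1 (l2_basis n)) * star (ip z (L2 (l2_basis n))))"
        unfolding sab_def a_def b_def using assms(8,9) by (intro infsum_cong) simp
      then show ?thesis using cross_term_positive[OF assms(7,6,13)] by simp
    qed
    have sbb_pos: "selfadjoint_square sbb"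
      by (rule selfadjoint_square_has_sum[OF sbb]) (rule selfadjoint_square_mult_star)
    have "selfadjoint_square (saa - C *\<^sub>R ip (K' z) (K' z))"
      using X(2)[of z] by (simp add: cstar_le_def cstar_positive_iff_square saa_def a_def)
    then have "selfadjoint_square ((saa - C *\<^sub>R ip (K' z) (K' z)) + (sbb + (sba + sab)))"
      by (intro selfadjoint_square_add sbb_pos sba_pos sab_pos)
    then have lower: "C *\<^sub>R ip (K' z) (K' z) \<le>\<^sub>A t"
      by (simp add: cstar_le_def cstar_positive_iff_square expand algebra_simps)
    (* Upper bound: with the parallelogram identity, the slack in both frame inequalities, taken twice,
       and the sum of all (a n - b n) * star (a n - b n) add up to 2 (D1 + D2) ip z z - t. *)
    have "selfadjoint_square (D1 *\<^sub>R ip z z - saa)" "selfadjoint_square (D2 *\<^sub>R ip z z - sbb)"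
      using X(3)[of z] Y(2)[of z]
      by (simp_all add: cstar_le_def cstar_positive_iff_square saa_def a_def sbb_def b_def)
    then have "selfadjoint_square (2 *\<^sub>R ((D1 *\<^sub>R ip z z - saa) + (D2 *\<^sub>R ip z z - sbb)))"
      by (intro selfadjoint_square_scaleR selfadjoint_square_add) simp_all
    moreover have "selfadjoint_square (2 *\<^sub>R (saa + sbb) - t)"
    proof (rule selfadjoint_square_has_sum)
      show "((\<lambda>n. 2 *\<^sub>R (a n * star (a n) + b n * star (b n)) - (a n + b n) * star (a n + b n))
          has_sum 2 *\<^sub>R (saa + sbb) - t) J"
        unfolding diff_conv_add_uminus
        by (intro has_sum_add has_sum_uminusI has_sum_bounded_linear[OF bounded_linear_scaleR_right]
            saa sbb t)
    qed (simp only: parallelogram selfadjoint_square_mult_star)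
    ultimately have "selfadjoint_square
        (2 *\<^sub>R ((D1 *\<^sub>R ip z z - saa) + (D2 *\<^sub>R ip z z - sbb)) + (2 *\<^sub>R (saa + sbb) - t))"
      by (rule selfadjoint_square_add)
    then have "t \<le>\<^sub>A (2 * (D1 + D2)) *\<^sub>R ip z z"
      by (simp add: cstar_le_def cstar_positive_iff_square algebra_simps)
    then show ?thesis using lower t_sum unfolding ab t_def by blast
  qed
  moreover have "2 * (D1 + D2) > 0" using C D2 by simp
  ultimately show ?thesis unfolding frame using C(1) by blast
qed

end
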